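(* Let $\varrho$ be a primitive, bijective substitution with expansion factor $Q$ on a finite alphabet $\mathcal{A}$. Assume that $k$ is a positive integer such that the word $a^{k+1}$ is not in the language of $\varrho$ for any letter $a\in\mathcal{A}$. Let $v\in\mathcal{A}^{\mathbb{Z}}$ be a repetitive fixed point of $\varrho$, let $X_v$ be the orbit closure of $v$ under the shift, and let $\mu$ be the unique shift-invariant probability measure on $X_v$. For $n>0$ and $a\in\mathcal{A}$ put \[ C_{n,a}=\{u\in X_{v}\mid u_{0}=u_{n}=u_{2n}=\cdots =u_{kn}=a\}. \] Then the following hold. (1) For some $n>0$ and some $a\in\mathcal{A}$, $\mu(C_{n,a})>0$. If $\mu(C_{n,a})>0$ and $n=Q^{s}n'$ for some integers $s\geq 0$ and $n'>0$, then $\mu(C_{n',b})>0$ for some $b\in\mathcal{A}$. Moreover, if $\mu(C_{n,a})>0$ and $m$ is such that for each letter $c\in\mathcal{A}$ the word $\varrho^{m}(c)$ contains all letters of $\mathcal{A}$, then $\mu(C_{Q^{m}n,b})>0$ for each letter $b\in\mathcal{A}$. (2) Suppose that $a\in\mathcal{A}$ and $n>0$ are such that $\mu(C_{n,a})>0$, and that $n$ and $Q$ are coprime. Then there is $m_{0}>0$ such that, for all $m>m_{0}$, there are no arithmetic progressions of the letter $a$ in $v$ with difference $d=Q^{m}+n$ or $d=Q^m-n$ and length $L=Q^{m}+k$. (3) Suppose that the cardinality of $\mathcal{A}$ is $2$. Then there are positive integers $n$ and $m_0$ such that, for all integers $s\geq 0$ and $m\geq m_0$, and for every letter of $\mathcal{A}$,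 there are no arithmetic progressions of that letter in $v$ with difference $Q^{m+s}+ Q^sn$ or $Q^{m+s}-Q^sn$ and length $Q^m+k$.
   Context: A substitution $\varrho$ on a finite alphabet $\mathcal{A}$ assigns to each letter a non-empty finite word and is extended to finite and bi-infinite words by concatenation. It has constant length (expansion factor) $Q$ if $|\varrho(a)|=Q$ for all $a\in\mathcal{A}$. A substitution of constant length $Q$ is bijective if, for every $0\le j<Q$, the map $a\mapsto \varrho(a)_j$ (the letter of $\varrho(a)$ at position $j$) is a bijection of $\mathcal{A}$. It is primitive if there is $m\geq 1$ such that $\varrho^m(a)$ contains every letter of $\mathcal{A}$, for every $a\in\mathcal{A}$. The language of $\varrho$ is the set of all finite words occurring as factors of some $\varrho^m(a)$, $a\in\mathcal{A}$, $m\in\mathbb{N}$. A bi-infinite fixed point $v=(v_i)_{i\in\mathbb{Z}}$ satisfies $\varrho(v)=v$, where $\varrho(v_0)$ occupies positions $0,\dots,Q-1$; it is repetitive if every factor of $v$ recurs in $v$ with bounded gaps. The orbit closure is taken in the product topology on $\mathcal{A}^{\mathbb{Z}}$ with respect to the shift map $T$, $(Tu)_i=u_{i+1}$. An arithmetic progression of the letter $a$ in $v$ with difference $d$ and length $L$ means that there is $t\in\mathbb{Z}$ with $v_t=v_{t+d}=\dots=v_{t+(L-1)d}=a$.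
   Formalization: The expansion factor is assumed to satisfy Q ≥ 2; for Q = 1 primitivity forces the identity substitution on a single letter, where v is constant, a^{k+1} is not in the language, and part (2) fails. *)

theory Defs
  imports "HOL-Probability.Probability" "HOL-Library.Sublist"
begin

text \<open>The alphabet is the universe of a finite type. A substitution is a map from letters to
  words (lists).\<close>

definition substitution :: "('a \<Rightarrow> 'a list) \<Rightarrow> bool" where
  "substitution \<rho> \<longleftrightarrow> (\<forall>a. \<rho> a \<noteq> [])"

definition subst_word :: "('a \<Rightarrow> 'a list) \<Rightarrow> 'a list \<Rightarrow> 'a list" where
  "subst_word \<rho> w = concat (map \<rho> w)"

definition subst_pow :: "('a \<Rightarrow> 'a list) \<Rightarrow> nat \<Rightarrow> 'a \<Rightarrow> 'a list" where
  "subst_pow \<rho> m a = (subst_word \<rho> ^^ m) [a]"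

definition constant_length :: "nat \<Rightarrow> ('a \<Rightarrow> 'a list) \<Rightarrow> bool" where
  "constant_length Q \<rho> \<longleftrightarrow> (\<forall>a. length (\<rho> a) = Q)"

definition bijective_subst :: "nat \<Rightarrow> ('a \<Rightarrow> 'a list) \<Rightarrow> bool" where
  "bijective_subst Q \<rho> \<longleftrightarrow> constant_length Q \<rho> \<and> (\<forall>j<Q. bij (\<lambda>a. \<rho> a ! j))"

definition primitive_subst :: "('a \<Rightarrow> 'a list) \<Rightarrow> bool" where
  "primitive_subst \<rho> \<longleftrightarrow> (\<exists>m\<ge>1. \<forall>a. set (subst_pow \<rho> m a) = UNIV)"

definition language :: "('a \<Rightarrow> 'a list) \<Rightarrow> 'a list set" where
  "language \<rho> = {w. \<exists>a m. sublist w (subst_pow \<rho> m a)}"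

text \<open>Extension by concatenation to bi-infinite words, for a substitution of constant length \<open>Q\<close>:
  the word \<open>\<rho> (v i)\<close> occupies the positions \<open>Q * i, \<dots>, Q * i + Q - 1\<close>. Here \<open>div\<close> and \<open>mod\<close> on
  integers round towards minus infinity.\<close>

definition subst_biinf :: "nat \<Rightarrow> ('a \<Rightarrow> 'a list) \<Rightarrow> (int \<Rightarrow> 'a) \<Rightarrow> (int \<Rightarrow> 'a)" where
  "subst_biinf Q \<rho> v = (\<lambda>i. \<rho> (v (i div int Q)) ! nat (i mod int Q))"

definition fixed_point :: "nat \<Rightarrow> ('a \<Rightarrow> 'a list) \<Rightarrow> (int \<Rightarrow> 'a) \<Rightarrow> bool" where
  "fixed_point Q \<rho> v \<longleftrightarrow> subst_biinf Q \<rho> v = v"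

definition occurs_at :: "(int \<Rightarrow> 'a) \<Rightarrow> 'a list \<Rightarrow> int \<Rightarrow> bool" where
  "occurs_at v w i \<longleftrightarrow> (\<forall>j<length w. v (i + int j) = w ! j)"

definition repetitive :: "(int \<Rightarrow> 'a) \<Rightarrow> bool" where
  "repetitive v \<longleftrightarrow>
    (\<forall>w. (\<exists>i. occurs_at v w i) \<longrightarrow> (\<exists>R::nat. \<forall>t. \<exists>i\<in>{t..t + int R}. occurs_at v w i))"

definition shift :: "(int \<Rightarrow> 'a) \<Rightarrow> (int \<Rightarrow> 'a)" where
  "shift u = (\<lambda>i. u (i + 1))"

definition full_shift_topology :: "(int \<Rightarrow> 'a) topology" where
  "full_shift_topology = product_topology (\<lambda>_. discrete_topology UNIV) UNIV"

text \<open>The closure of the two-sided orbit: the map \<open>\<lambda>i. v (i + n)\<close> is the \<open>n\<close>-th iterate of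
  \<^const>\<open>shift\<close> on \<open>v\<close>, where \<open>n\<close> may be negative.\<close>

definition orbit_closure :: "(int \<Rightarrow> 'a) \<Rightarrow> (int \<Rightarrow> 'a) set" where
  "orbit_closure v = full_shift_topology closure_of (range (\<lambda>n::int. \<lambda>i. v (i + n)))"

text \<open>Shift-invariant Borel probability measures on a subspace \<open>X\<close> of the full shift.\<close>

definition invariant_prob :: "(int \<Rightarrow> 'a) set \<Rightarrow> (int \<Rightarrow> 'a) measure \<Rightarrow> bool" where
  "invariant_prob X M \<longleftrightarrow>
    prob_space M \<and> space M = X \<and>
    sets M = sigma_sets X {U. openin (subtopology full_shift_topology X) U} \<and>
    shift \<in> measurable M M \<and> distr M M shift = M"

definition C_set :: "nat \<Rightarrow> (int \<Rightarrow> 'a) \<Rightarrow> nat \<Rightarrow> 'a \<Rightarrow> (int \<Rightarrow> 'a) set" where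
  "C_set k v n a = {u \<in> orbit_closure v. \<forall>j\<le>k. u (int (j * n)) = a}"

definition has_AP :: "(int \<Rightarrow> 'a) \<Rightarrow> 'a \<Rightarrow> int \<Rightarrow> nat \<Rightarrow> bool" where
  "has_AP v a d L \<longleftrightarrow> (\<exists>t. \<forall>j<L. v (t + int j * d) = a)"

end

theory Submission
  imports Defs "HOL-Number_Theory.Cong"
begin

text \<open>Two facts drive everything. A fixed point is self-similar: for r < Q^m the letter of v
  at Q^m x + r is the image of v x under the r-th column of \<rho>^m, and bijectivity makes every
  column a permutation of the alphabet (\<open>fixed_point_pow\<close>,
  \<open>bij_nth_subst_pow\<close>). And by repetitivity, positive measure of
  \<open>C_set k v n a\<close> just says that v itself contains k + 1 letters a spaced by n
  (\<open>measure_C_set_pos_iff\<close>), so the measure disappears from the problem.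

  Scaling the difference by Q^s amounts to substituting or desubstituting, since the terms of a
  progression whose difference is divisible by Q^s all lie in one column. For existence, iterating a
  column N times, with N a common exponent of all permutations, returns the starting letter; for the
  columns 0, ..., k this gives a pattern of every letter, with one difference coprime to Q
  (\<open>exists_coprime_pattern\<close>).

  For the upper bound, a progression with difference Q^m + n, n coprime to Q, meets every residue
  modulo Q^m, and each further term moves to the next block while advancing by n inside it. From the
  start of a pattern of a inside \<rho>^m(c), the next k terms fall where \<rho>^m(c) also shows a;
  injectivity of columns then forces the forbidden power c^(k+1) in v
  (\<open>AP_forces_power\<close>, \<open>no_long_AP\<close>).\<close>

section \<open>A common exponent for all permutations of a finite set\<close>

lemma finite_bij_funpow_id:
  fixes f :: "'a::finite \<Rightarrow> 'a"
  assumes "bij f"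
  shows "\<exists>N>0. f ^^ N = id"
proof -
  have "\<not> inj (\<lambda>n::nat. f ^^ n)"
    using finite_imageD[of "\<lambda>n::nat. f ^^ n" UNIV] by auto
  then obtain m n where eq: "f ^^ m = f ^^ n" and "m < n"
    by (metis injI linorder_neqE_nat)
  have "f ^^ n = f ^^ m \<circ> f ^^ (n - m)"
    using \<open>m < n\<close> by (simp flip: funpow_add)
  moreover have "inj (f ^^ m)"
    using assms by (simp add: bij_is_inj inj_fn)
  ultimately have "f ^^ (n - m) = id"
    by (metis eq comp_apply eq_id_iff injD)
  with \<open>m < n\<close> show ?thesis
    by (metis zero_less_diff)
qed

text \<open>The product of the individual orders works. A single exponent is needed because the
  columns 0, ..., k must all return to the identity after the same number of iterations, so that the
  resulting positions are equally spaced.\<close>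

lemma finite_bij_funpow_id_uniform:
  "\<exists>N>0. \<forall>f::'a::finite \<Rightarrow> 'a. bij f \<longrightarrow> f ^^ N = id"
proof -
  obtain ord where ord: "\<And>f::'a \<Rightarrow> 'a. bij f \<Longrightarrow> 0 < ord f \<and> f ^^ ord f = id"
    using finite_bij_funpow_id by metis
  define N where "N = (\<Prod>f | bij (f::'a \<Rightarrow> 'a). ord f)"
  have "f ^^ N = id" if "bij f" for f :: "'a \<Rightarrow> 'a"
  proof -
    have "ord f dvd N"
      unfolding N_def using that by (intro dvd_prodI) auto
    then obtain c where "N = ord f * c" ..
    then show ?thesis
      using ord[OF that] funpow_mult[where f = f and m = "ord f" and n = c] by simp
  qed
  moreover have "N > 0"
    unfolding N_def using ord by (intro prod_pos) auto
  ultimately show ?thesis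
    by blast
qed

section \<open>Columns of the iterated substitution\<close>

lemma length_subst_word:
  assumes "constant_length Q \<rho>"
  shows "length (subst_word \<rho> w) = Q * length w"
  using assms by (induction w) (auto simp: subst_word_def constant_length_def)

lemma nth_subst_word:
  assumes "constant_length Q \<rho>" and "i < length w" and "r < Q"
  shows "subst_word \<rho> w ! (Q * i + r) = \<rho> (w ! i) ! r"
  using assms(2)
proof (induction w arbitrary: i)
  case (Cons a w)
  then show ?case
    using assms(1,3) by (cases i) (auto simp: subst_word_def constant_length_def nth_append)
qed simp

lemma subst_pow_0: "subst_pow \<rho> 0 a = [a]"
  by (simp add: subst_pow_def)

lemma subst_pow_Suc: "subst_pow \<rho> (Suc m) a = subst_word \<rho> (subst_pow \<rho> m a)"
  by (simp add: subst_pow_def)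

lemma length_subst_pow:
  assumes "constant_length Q \<rho>"
  shows "length (subst_pow \<rho> m a) = Q ^ m"
  by (induction m) (simp_all add: subst_pow_0 subst_pow_Suc length_subst_word[OF assms])

lemma nth_subst_pow_Suc:
  assumes "constant_length Q \<rho>" and "r < Q ^ Suc m"
  shows "subst_pow \<rho> (Suc m) a ! r = \<rho> (subst_pow \<rho> m a ! (r div Q)) ! (r mod Q)"
proof -
  have "Q > 0"
    using assms(2) by (cases Q) auto
  then have "r div Q < Q ^ m"
    using assms(2) by (simp add: div_less_iff_less_mult mult.commute)
  then show ?thesis
    using nth_subst_word[OF assms(1), of "r div Q" "subst_pow \<rho> m a" "r mod Q"] \<open>Q > 0\<close>
    by (simp add: subst_pow_Suc length_subst_pow[OF assms(1)])
qed

text \<open>Column r of \<rho>^m is the composition of the columns of \<rho> selected by the m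
  base-Q digits of r.\<close>

lemma bij_nth_subst_pow:
  assumes "bijective_subst Q \<rho>" and "r < Q ^ m"
  shows "bij (\<lambda>a. subst_pow \<rho> m a ! r)"
  using assms(2)
proof (induction m arbitrary: r)
  case 0
  then show ?case
    using bij_id by (simp add: subst_pow_0 id_def)
next
  case (Suc m)
  have cl: "constant_length Q \<rho>" and col: "\<And>j. j < Q \<Longrightarrow> bij (\<lambda>a. \<rho> a ! j)"
    using assms(1) by (auto simp: bijective_subst_def)
  have "Q > 0"
    using Suc.prems by (cases Q) auto
  then have "r div Q < Q ^ m"
    using Suc.prems by (simp add: div_less_iff_less_mult mult.commute)
  then have "bij ((\<lambda>a. \<rho> a ! (r mod Q)) \<circ> (\<lambda>a. subst_pow \<rho> m a ! (r div Q)))"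
    using Suc.IH col[of "r mod Q"] \<open>Q > 0\<close> by (intro bij_comp) auto
  then show ?case
    using nth_subst_pow_Suc[OF cl Suc.prems] by (simp add: comp_def)
qed

section \<open>Fixed points as concatenations of blocks\<close>

lemma fixed_point_step:
  assumes "fixed_point Q \<rho> v" and "r < Q"
  shows "v (int Q * i + int r) = \<rho> (v i) ! r"
proof -
  have "v (int Q * i + int r) = subst_biinf Q \<rho> v (int Q * i + int r)"
    using assms(1) by (simp add: fixed_point_def)
  then show ?thesis
    using assms(2) by (simp add: subst_biinf_def)
qed

lemma fixed_point_pow:
  assumes "constant_length Q \<rho>" and "fixed_point Q \<rho> v" and "r < Q ^ m"
  shows "v (int Q ^ m * i + int r) = subst_pow \<rho> m (v i) ! r"
  using assms(3)
proof (induction m arbitrary: r)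
  case 0
  then show ?case
    by (simp add: subst_pow_0)
next
  case (Suc m)
  have "Q > 0"
    using Suc.prems by (cases Q) auto
  then have less: "r div Q < Q ^ m"
    using Suc.prems by (simp add: div_less_iff_less_mult mult.commute)
  have "int r = int Q * int (r div Q) + int (r mod Q)"
    by (simp flip: of_nat_mult of_nat_add)
  then have "v (int Q ^ Suc m * i + int r)
      = v (int Q * (int Q ^ m * i + int (r div Q)) + int (r mod Q))"
    by (simp add: algebra_simps)
  also have "\<dots> = \<rho> (subst_pow \<rho> m (v i) ! (r div Q)) ! (r mod Q)"
    using \<open>Q > 0\<close> fixed_point_step[OF assms(2)] Suc.IH[OF less] by simp
  finally show ?case
    using nth_subst_pow_Suc[OF assms(1) Suc.prems] by simp
qed

text \<open>An occurrence across the origin is not visibly inside an iterate of one letter.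
  Repetitivity moves it to nonnegative positions, where v begins with \<rho>^m(v 0) for every
  m.\<close>

lemma occurs_at_in_language:
  assumes "constant_length Q \<rho>" and "fixed_point Q \<rho> v" and "2 \<le> Q" and "repetitive v"
    and "occurs_at v w i"
  shows "w \<in> language \<rho>"
proof -
  obtain R :: nat where "\<forall>t. \<exists>i\<in>{t..t + int R}. occurs_at v w i"
    using assms(4,5) unfolding repetitive_def by blast
  then obtain i' where "i' \<ge> 0" and "occurs_at v w i'"
    by (meson atLeastAtMost_iff)
  then obtain p where occ: "occurs_at v w (int p)"
    using nonneg_int_cases by metis
  define m where "m = p + length w"
  have m: "p + length w \<le> Q ^ m"
    unfolding m_def using power_gt_expt[of Q "p + length w"] assms(3) by simp
  have "w = take (length w) (drop p (subst_pow \<rho> m (v 0)))"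
  proof (rule nth_equalityI)
    fix j assume j: "j < length w"
    then show "w ! j = take (length w) (drop p (subst_pow \<rho> m (v 0))) ! j"
      using m occ fixed_point_pow[OF assms(1,2), of "p + j" m 0]
      by (simp add: length_subst_pow[OF assms(1)] occurs_at_def)
  qed (use m in \<open>simp add: length_subst_pow[OF assms(1)]\<close>)
  then have "sublist w (subst_pow \<rho> m (v 0))"
    using sublist_order.order_trans[OF sublist_take sublist_drop] by metis
  then show ?thesis
    unfolding language_def by blast
qed

section \<open>Positive measure as occurrence of a pattern\<close>

lemma openin_full_shift_cylinder:
  assumes "finite F"
  shows "openin full_shift_topology {w. \<forall>i\<in>F. w i = u i}"
proof -
  define U where "U = (\<lambda>i. if i \<in> F then {u i} else UNIV)"
  have "openin full_shift_topology (Pi\<^sub>E UNIV U)"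
    unfolding full_shift_topology_def
    by (rule product_topology_basis)
      (auto simp: U_def intro: finite_subset[OF _ assms])
  moreover have "Pi\<^sub>E UNIV U = {w. \<forall>i\<in>F. w i = u i}"
    by (auto simp: U_def PiE_UNIV_domain split: if_splits)
  ultimately show ?thesis
    by simp
qed

lemma orbit_closure_finite_agree:
  assumes "u \<in> orbit_closure v" and "finite F"
  obtains s where "\<forall>i\<in>F. v (i + s) = u i"
proof -
  have "\<And>T. u \<in> T \<Longrightarrow> openin full_shift_topology T \<Longrightarrow>
      \<exists>w\<in>range (\<lambda>n i. v (i + n)). w \<in> T"
    using assms(1) by (simp add: orbit_closure_def in_closure_of)
  from this[OF _ openin_full_shift_cylinder[OF assms(2), of u]] show ?thesis
    using that by auto
qed

text \<open>The event behind \<open>C_set k v n a\<close>, read off v itself up to translation; the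
  later arguments use it in place of the measure.\<close>

definition has_pattern :: "(int \<Rightarrow> 'a) \<Rightarrow> nat \<Rightarrow> nat \<Rightarrow> 'a \<Rightarrow> bool" where
  "has_pattern v k n a \<longleftrightarrow> (\<exists>t. \<forall>j\<le>k. v (t + int (j * n)) = a)"

lemma has_pattern_syndetic:
  assumes "repetitive v" and "has_pattern v k n a"
  obtains R :: nat where "\<And>s. \<exists>i\<le>R. \<forall>j\<le>k. v (s + int i + int (j * n)) = a"
proof -
  obtain t where t: "\<forall>j\<le>k. v (t + int (j * n)) = a"
    using assms(2) by (auto simp: has_pattern_def)
  \<comment> \<open>The pattern spans \<open>k * n + 1\<close> letters, so its recurrence is that of
    one finite factor.\<close>
  define w where "w = map (\<lambda>l. v (t + int l)) [0..<Suc (k * n)]"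
  have "occurs_at v w t"
    by (simp add: occurs_at_def w_def del: upt_Suc)
  then obtain R :: nat where R: "\<forall>s. \<exists>i\<in>{s..s + int R}. occurs_at v w i"
    using assms(1) unfolding repetitive_def by blast
  have "\<exists>i\<le>R. \<forall>j\<le>k. v (s + int i + int (j * n)) = a" for s
  proof -
    obtain x where x: "x \<in> {s..s + int R}" "occurs_at v w x"
      using R by blast
    have "v (x + int (j * n)) = a" if "j \<le> k" for j
    proof -
      have "j * n < Suc (k * n)"
        using that by (simp add: less_Suc_eq_le)
      then show ?thesis
        using x(2) t that by (auto simp: occurs_at_def w_def simp del: upt_Suc)
    qed
    moreover have "x = s + int (nat (x - s))" "nat (x - s) \<le> R"
      using x(1) by auto
    ultimately show ?thesis
      by metis
  qed
  then show ?thesis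
    using that by blast
qed

text \<open>Repetitivity makes the pattern occur in every window of some fixed length, so finitely many
  preimages of the cylinder under the shift cover the whole space.\<close>

lemma measure_C_set_pos_iff:
  fixes v :: "int \<Rightarrow> 'a"
  assumes "invariant_prob (orbit_closure v) \<mu>" and "repetitive v"
  shows "measure \<mu> (C_set k v n a) > 0 \<longleftrightarrow> has_pattern v k n a"
proof
  define F where "F = (\<lambda>j. int (j * n)) ` {..k}"
  assume "measure \<mu> (C_set k v n a) > 0"
  then have "C_set k v n a \<noteq> {}"
    by auto
  then obtain u where u: "u \<in> orbit_closure v" "\<forall>j\<le>k. u (int (j * n)) = a"
    by (auto simp: C_set_def)
  obtain s where "\<forall>i\<in>F. v (i + s) = u i"
    using orbit_closure_finite_agree[OF u(1), of F] F_def by auto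
  then show "has_pattern v k n a"
    using u(2) unfolding has_pattern_def F_def by (intro exI[of _ s]) (auto simp: add.commute)
next
  let ?C = "C_set k v n a"
  assume "has_pattern v k n a"
  then obtain R :: nat where R: "\<And>s. \<exists>i\<le>R. \<forall>j\<le>k. v (s + int i + int (j * n)) = a"
    using has_pattern_syndetic[OF assms(2)] by blast
  have prob: "prob_space \<mu>" and space: "space \<mu> = orbit_closure v"
    and sets: "sets \<mu> = sigma_sets (orbit_closure v)
        {U. openin (subtopology full_shift_topology (orbit_closure v)) U}"
    and shift_meas: "shift \<in> measurable \<mu> \<mu>" and inv: "distr \<mu> \<mu> shift = \<mu>"
    using assms(1) by (auto simp: invariant_prob_def)
  interpret prob_space \<mu>
    by (fact prob)
  have "?C = {w. \<forall>i\<in>(\<lambda>j. int (j * n)) ` {..k}. w i = a} \<inter> orbit_closure v"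
    by (auto simp: C_set_def)
  then have "openin (subtopology full_shift_topology (orbit_closure v)) ?C"
    using openin_full_shift_cylinder[of "(\<lambda>j. int (j * n)) ` {..k}" "\<lambda>_. a"]
    by (auto simp: openin_subtopology)
  then have C_sets: "?C \<in> sets \<mu>"
    by (simp add: sets sigma_sets.Basic)
  have pow_meas: "shift ^^ i \<in> measurable \<mu> \<mu>" for i
    by (rule measurable_compose_n[OF shift_meas])
  have pow_inv: "distr \<mu> \<mu> (shift ^^ i) = \<mu>" for i
  proof (induction i)
    case 0
    then show ?case
      by (simp add: id_def distr_id)
  next
    case (Suc i)
    then show ?case
      using distr_distr[OF shift_meas pow_meas[of i]] inv by (simp add: comp_def)
  qed
  have pow_apply: "(shift ^^ i) u x = u (x + int i)" for i u x
    by (induction i arbitrary: x) (simp_all add: shift_def algebra_simps)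
  have preimage_sets: "(shift ^^ i) -` ?C \<inter> space \<mu> \<in> sets \<mu>" for i
    by (rule measurable_sets[OF pow_meas C_sets])
  have cover: "space \<mu> \<subseteq> (\<Union>i\<le>R. (shift ^^ i) -` ?C \<inter> space \<mu>)"
  proof
    fix u assume u: "u \<in> space \<mu>"
    \<comment> \<open>The window has room for every possible start \<open>i \<le> R\<close> together
      with the \<open>k * n\<close> letters after it.\<close>
    obtain s where s: "\<forall>i\<in>{0..int (R + k * n)}. v (i + s) = u i"
      using orbit_closure_finite_agree[of u v "{0..int (R + k * n)}"] u space by auto
    obtain i where i: "i \<le> R" "\<forall>j\<le>k. v (s + int i + int (j * n)) = a"
      using R by blast
    have "u (int (j * n) + int i) = a" if "j \<le> k" for j
    proof -
      have "int (j * n) + int i \<in> {0..int (R + k * n)}"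
        using add_mono[OF mult_le_mono1[OF that, of n] i(1)]
        by (simp flip: of_nat_mult of_nat_add add: add.commute)
      then have "u (int (j * n) + int i) = v (int (j * n) + int i + s)"
        using s by simp
      also have "\<dots> = a"
        using i(2) that by (simp add: algebra_simps)
      finally show ?thesis .
    qed
    moreover have "(shift ^^ i) u \<in> orbit_closure v"
      using measurable_space[OF pow_meas u] space by simp
    ultimately have "(shift ^^ i) u \<in> ?C"
      by (simp add: C_set_def pow_apply)
    then show "u \<in> (\<Union>i\<le>R. (shift ^^ i) -` ?C \<inter> space \<mu>)"
      using u i(1) by auto
  qed
  \<comment> \<open>Union bound: R + 1 preimages of equal measure cover the whole space.\<close>
  have "1 = measure \<mu> (space \<mu>)"
    by (simp add: prob_space)
  also have "\<dots> \<le> measure \<mu> (\<Union>i\<le>R. (shift ^^ i) -` ?C \<inter> space \<mu>)"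
    by (rule finite_measure_mono[OF cover sets.finite_UN[OF finite_atMost preimage_sets]])
  also have "\<dots> \<le> (\<Sum>i\<le>R. measure \<mu> ((shift ^^ i) -` ?C \<inter> space \<mu>))"
    using preimage_sets by (intro finite_measure_subadditive_finite) blast+
  also have "\<dots> = (\<Sum>i\<le>R. measure \<mu> ?C)"
    using measure_distr[OF pow_meas C_sets] pow_inv by simp
  finally have "1 \<le> real (Suc R) * measure \<mu> ?C"
    by simp
  then have "measure \<mu> ?C \<noteq> 0"
    by auto
  then show "measure \<mu> ?C > 0"
    by (simp add: zero_less_measure_iff)
qed

section \<open>Substituting and desubstituting progressions\<close>

lemma letter_occurs:
  fixes v :: "int \<Rightarrow> 'a"
  assumes "primitive_subst \<rho>" and "constant_length Q \<rho>" and "fixed_point Q \<rho> v"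
  shows "\<exists>x. v x = a"
proof -
  obtain m where "set (subst_pow \<rho> m (v 0)) = UNIV"
    using assms(1) by (auto simp: primitive_subst_def)
  then obtain r where "r < Q ^ m" "subst_pow \<rho> m (v 0) ! r = a"
    by (metis UNIV_I in_set_conv_nth length_subst_pow[OF assms(2)])
  then show ?thesis
    using fixed_point_pow[OF assms(2,3), of r m 0] by auto
qed

text \<open>All terms share one residue r modulo Q^s, hence are images under the same column of
  \<rho>^s. That column is injective, so their preimages, spaced by d, are equal as well.\<close>

lemma has_AP_desubstitute:
  assumes "bijective_subst Q \<rho>" and "fixed_point Q \<rho> v" and "Q > 0"
    and "has_AP v a (int Q ^ s * d) L"
  shows "\<exists>b. has_AP v b d L"
proof -
  have cl: "constant_length Q \<rho>"
    using assms(1) by (simp add: bijective_subst_def)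
  obtain t where t: "\<forall>j<L. v (t + int j * (int Q ^ s * d)) = a"
    using assms(4) by (auto simp: has_AP_def)
  define x where "x = t div int Q ^ s"
  define r where "r = nat (t mod int Q ^ s)"
  have pos: "int Q ^ s > 0"
    using assms(3) by simp
  then have int_r: "int r = t mod int Q ^ s"
    by (simp add: r_def)
  then have r: "r < Q ^ s"
    using pos by (metis of_nat_less_iff of_nat_power pos_mod_bound)
  have bij: "bij (\<lambda>a. subst_pow \<rho> s a ! r)"
    using bij_nth_subst_pow[OF assms(1) r] .
  have "v (x + int j * d) = inv (\<lambda>a. subst_pow \<rho> s a ! r) a" if "j < L" for j
  proof -
    have "t + int j * (int Q ^ s * d) = int Q ^ s * (x + int j * d) + int r"
      by (simp add: int_r x_def algebra_simps)
    then have "subst_pow \<rho> s (v (x + int j * d)) ! r = a"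
      using t that fixed_point_pow[OF cl assms(2) r] by metis
    then show ?thesis
      using inv_f_f[OF bij_is_inj[OF bij], of "v (x + int j * d)"] by simp
  qed
  then show ?thesis
    unfolding has_AP_def by blast
qed

lemma has_pattern_iff_has_AP: "has_pattern v k n a \<longleftrightarrow> has_AP v a (int n) (k + 1)"
  by (auto simp: has_pattern_def has_AP_def less_Suc_eq_le)

text \<open>Every block \<rho>^m(a) carries b at the same position r, and the starts of the blocks
  are spread out by the factor Q^m.\<close>

lemma has_pattern_substitute:
  assumes "constant_length Q \<rho>" and "fixed_point Q \<rho> v"
    and "has_pattern v k n a" and "b \<in> set (subst_pow \<rho> m a)"
  shows "has_pattern v k (Q ^ m * n) b"
proof -
  obtain t where t: "\<forall>j\<le>k. v (t + int (j * n)) = a"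
    using assms(3) by (auto simp: has_pattern_def)
  obtain r where r: "r < Q ^ m" "subst_pow \<rho> m a ! r = b"
    using assms(4) by (metis in_set_conv_nth length_subst_pow[OF assms(1)])
  have "v (int Q ^ m * t + int r + int (j * (Q ^ m * n))) = b" if "j \<le> k" for j
  proof -
    have "int Q ^ m * t + int r + int (j * (Q ^ m * n)) = int Q ^ m * (t + int (j * n)) + int r"
      by (simp add: algebra_simps)
    then show ?thesis
      using fixed_point_pow[OF assms(1,2) r(1)] t that r(2) by metis
  qed
  then show ?thesis
    unfolding has_pattern_def by blast
qed

text \<open>If \<open>h\<close> is the \<open>i\<close>-th column of \<open>\<rho>\<^sup>m\<close>, then \<open>v (Q\<^sup>m x + i) = h (v x)\<close>. Iterating \<open>N\<close> times,
  where \<open>h\<^sup>N = id\<close> for all columns, yields the letter \<open>v x\<close> at \<open>Q\<^sup>m\<^sup>N x + i n\<close> with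
  \<open>n = 1 + Q\<^sup>m + \<dots> + Q\<^sup>m\<^sup>(\<^sup>N\<^sup>-\<^sup>1\<^sup>)\<close>, for every \<open>i < Q\<^sup>m\<close>.\<close>

lemma exists_coprime_pattern:
  fixes v :: "int \<Rightarrow> 'a::finite"
  assumes "primitive_subst \<rho>" and "bijective_subst Q \<rho>" and "fixed_point Q \<rho> v" and "2 \<le> Q"
  shows "\<exists>n>0. coprime n Q \<and> (\<forall>a. has_pattern v k n a)"
proof -
  have cl: "constant_length Q \<rho>"
    using assms(2) by (simp add: bijective_subst_def)
  obtain N where N: "N > 0" "\<And>f::'a \<Rightarrow> 'a. bij f \<Longrightarrow> f ^^ N = id"
    using finite_bij_funpow_id_uniform by metis
  \<comment> \<open>This choice gives k < Q^m, so each i \<le> k is a column index; and m > 0 makes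
    the difference \<open>e N\<close> congruent to 1 modulo Q.\<close>
  define m where "m = Suc k"
  define e where "e = (\<lambda>N::nat. \<Sum>l<N. (Q ^ m) ^ l)"
  have e_Suc: "e (Suc M) = Q ^ m * e M + 1" for M
    unfolding e_def by (subst sum.lessThan_Suc_shift) (simp add: sum_distrib_left)
  have k_less: "k < Q ^ m"
    using power_gt_expt[of Q m] assms(4) by (simp add: m_def)
  have iter: "v (int (Q ^ m) ^ M * x + int (i * e M)) = ((\<lambda>a. subst_pow \<rho> m a ! i) ^^ M) (v x)"
    if "i < Q ^ m" for i x M
  proof (induction M)
    case 0
    then show ?case
      by (simp add: e_def)
  next
    case (Suc M)
    have "int (Q ^ m) ^ Suc M * x + int (i * e (Suc M))
        = int Q ^ m * (int (Q ^ m) ^ M * x + int (i * e M)) + int i"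
      by (simp add: e_Suc algebra_simps)
    then show ?case
      using fixed_point_pow[OF cl assms(3) that] Suc.IH by simp
  qed
  obtain M where M: "N = Suc M"
    using N(1) by (cases N) auto
  have "e N > 0"
    by (simp add: M e_Suc)
  moreover have "coprime (e N) Q"
  proof (rule coprimeI)
    fix c assume "c dvd e N" "c dvd Q"
    then show "is_unit c"
      using dvd_add_right_iff[of c "Q ^ m * e M" 1] by (simp add: M e_Suc m_def)
  qed
  moreover have "has_pattern v k (e N) a" for a
  proof -
    obtain x where "v x = a"
      using letter_occurs[OF assms(1) cl assms(3)] by blast
    then have "\<forall>j\<le>k. v (int (Q ^ m) ^ N * x + int (j * e N)) = a"
      using k_less iter N(2) bij_nth_subst_pow[OF assms(2)] by simp
    then show ?thesis
      unfolding has_pattern_def by blast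
  qed
  ultimately show ?thesis
    by blast
qed

section \<open>Excluding long progressions\<close>

text \<open>As d is invertible modulo M, the congruence for j is solvable. The bound j < M matters:
  a progression of length M + k still has k terms after this one.\<close>

lemma progression_hits_residue:
  fixes t d p :: int and M :: nat
  assumes "coprime d (int M)" and "M > 0"
  shows "\<exists>j<M. (t + int j * d) mod int M = p mod int M"
proof -
  obtain y where y: "[d * y = 1] (mod int M)"
    using assms(1) cong_solve_coprime_int by blast
  define j where "j = nat (((p - t) * y) mod int M)"
  have int_j: "int j = ((p - t) * y) mod int M"
    using assms(2) by (simp add: j_def)
  then have "int j < int M"
    using assms(2) by simp
  moreover have "[t + int j * d = p] (mod int M)"
  proof -
    have "[int j * d = (p - t) * y * d] (mod int M)"
      unfolding int_j by (intro cong_mult) (auto simp: cong_def)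
    moreover have "[(p - t) * (d * y) = (p - t) * 1] (mod int M)"
      using y by (intro cong_mult) auto
    ultimately have "[int j * d = p - t] (mod int M)"
      by (metis cong_trans mult.assoc mult.commute mult.right_neutral)
    then have "[t + int j * d = t + (p - t)] (mod int M)"
      by (intro cong_add) auto
    then show ?thesis
      by simp
  qed
  ultimately show ?thesis
    by (auto simp: cong_def)
qed

text \<open>A progression of length \<open>Q\<^sup>m + k\<close> whose difference is \<open>Q\<^sup>m + e\<close> meets position \<open>p\<close> of some
  block \<open>\<rho>\<^sup>m(v q)\<close> with \<open>k\<close> terms still to come. These lie at the positions \<open>p + l e\<close> of the
  consecutive blocks \<open>\<rho>\<^sup>m(v (q + l))\<close>. As \<open>\<rho>\<^sup>m(c)\<close> has the same letter there and columns are
  injective, all \<open>v (q + l)\<close> equal \<open>c\<close>.\<close>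

lemma AP_forces_power:
  fixes e :: int
  assumes "bijective_subst Q \<rho>" and "fixed_point Q \<rho> v" and "2 \<le> Q"
    and "coprime (int Q ^ m + e) (int Q ^ m)"
    and pattern: "\<And>l. l \<le> k \<Longrightarrow> 0 \<le> p + int l * e \<and> p + int l * e < int Q ^ m
      \<and> subst_pow \<rho> m c ! nat (p + int l * e) = a"
    and "has_AP v a (int Q ^ m + e) (Q ^ m + k)"
  shows "\<exists>q. occurs_at v (replicate (k + 1) c) q"
proof -
  have cl: "constant_length Q \<rho>"
    using assms(1) by (simp add: bijective_subst_def)
  let ?d = "int Q ^ m + e"
  obtain t where t: "\<And>j. j < Q ^ m + k \<Longrightarrow> v (t + int j * ?d) = a"
    using assms(6) by (auto simp: has_AP_def)
  obtain j where j: "j < Q ^ m" "(t + int j * ?d) mod int Q ^ m = p mod int Q ^ m"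
    using progression_hits_residue[of ?d "Q ^ m" t p] assms(3,4) by auto
  define q where "q = (t + int j * ?d) div int Q ^ m"
  have "p mod int Q ^ m = p"
    using pattern[of 0] by simp
  then have start: "t + int j * ?d = int Q ^ m * q + p"
    using j(2) unfolding q_def by (metis mult_div_mod_eq)
  have "v (q + int l) = c" if "l \<le> k" for l
  proof -
    let ?r = "nat (p + int l * e)"
    have int_r: "int ?r = p + int l * e"
      using pattern[OF that] by simp
    have "int ?r < int (Q ^ m)"
      using pattern[OF that] int_r by simp
    then have r: "?r < Q ^ m"
      using of_nat_less_iff by blast
    have "t + int (j + l) * ?d = (t + int j * ?d) + int l * ?d"
      by (simp add: algebra_simps)
    also have "\<dots> = int Q ^ m * (q + int l) + int ?r"
      unfolding start int_r by (simp add: algebra_simps)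
    finally have "subst_pow \<rho> m (v (q + int l)) ! ?r = a"
      using t[of "j + l"] j(1) that fixed_point_pow[OF cl assms(2) r, of "q + int l"] by simp
    then show ?thesis
      using pattern[OF that]
        injD[OF bij_is_inj[OF bij_nth_subst_pow[OF assms(1) r]], of "v (q + int l)" c]
      by simp
  qed
  then show ?thesis
    by (auto simp: occurs_at_def less_Suc_eq_le simp del: replicate_Suc intro!: exI[of _ q])
qed

text \<open>Recurrence puts a pattern of a at nonnegative positions, so it lies inside \<rho>^m(v 0)
  for all large m. Then \<open>AP_forces_power\<close> with c = v 0 would produce k + 1 consecutive
  copies of v 0, a word outside the language.\<close>

lemma no_long_AP:
  fixes v :: "int \<Rightarrow> 'a"
  assumes "bijective_subst Q \<rho>" and "fixed_point Q \<rho> v" and "2 \<le> Q" and "repetitive v"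
    and "\<And>a. replicate (k + 1) a \<notin> language \<rho>"
    and "coprime n Q" and "has_pattern v k n a"
  shows "\<exists>m\<^sub>0>0. \<forall>m>m\<^sub>0.
           \<not> has_AP v a (int Q ^ m + int n) (Q ^ m + k) \<and>
           \<not> has_AP v a (int Q ^ m - int n) (Q ^ m + k)"
proof -
  have cl: "constant_length Q \<rho>"
    using assms(1) by (simp add: bijective_subst_def)
  obtain p where p: "\<And>j. j \<le> k \<Longrightarrow> v (int p + int (j * n)) = a"
  proof -
    obtain R :: nat where "\<And>s. \<exists>i\<le>R. \<forall>j\<le>k. v (s + int i + int (j * n)) = a"
      using has_pattern_syndetic[OF assms(4,7)] by blast
    from this[of 0] show ?thesis
      using that by auto
  qed
  have none: "\<not> has_AP v a (int Q ^ m + e) (Q ^ m + k)"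
    if "coprime (int Q ^ m + e) (int Q ^ m)"
      and "\<And>l. l \<le> k \<Longrightarrow> 0 \<le> p' + int l * e \<and> p' + int l * e < int Q ^ m
        \<and> subst_pow \<rho> m (v 0) ! nat (p' + int l * e) = a" for m e p'
    using AP_forces_power[OF assms(1-3) that] occurs_at_in_language[OF cl assms(2-4)] assms(5)
    by blast
  have col: "int (p + l * n) < int Q ^ m \<and> subst_pow \<rho> m (v 0) ! (p + l * n) = a"
    if "p + k * n < m" "l \<le> k" for l m
  proof -
    have "p + l * n \<le> p + k * n"
      using that(2) by simp
    also have "\<dots> < Q ^ m"
      using that(1) power_gt_expt[of Q m] assms(3) by simp
    finally have less: "p + l * n < Q ^ m" .
    then have "int (p + l * n) < int (Q ^ m)"
      by (simp only: of_nat_less_iff)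
    then show ?thesis
      using p[OF that(2)] fixed_point_pow[OF cl assms(2) less, of 0] by simp
  qed
  have cop: "coprime (int Q ^ m + int n) (int Q ^ m)" "coprime (int Q ^ m - int n) (int Q ^ m)"
    for m
  proof -
    have "coprime (int n) (int Q ^ m)"
      using assms(6) by simp
    then show "coprime (int Q ^ m + int n) (int Q ^ m)"
      "coprime (int Q ^ m - int n) (int Q ^ m)"
      by (simp_all add: coprime_iff_gcd_eq_1 gcd_diff2 add.commute)
  qed
  have "\<not> has_AP v a (int Q ^ m + int n) (Q ^ m + k) \<and>
        \<not> has_AP v a (int Q ^ m - int n) (Q ^ m + k)" if "m > p + k * n + 1" for m
  proof
    show "\<not> has_AP v a (int Q ^ m + int n) (Q ^ m + k)"
    proof (rule none[of m "int n" "int p"])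
      fix l assume "l \<le> k"
      have eq: "int p + int l * int n = int (p + l * n)"
        by simp
      show "0 \<le> int p + int l * int n \<and> int p + int l * int n < int Q ^ m
          \<and> subst_pow \<rho> m (v 0) ! nat (int p + int l * int n) = a"
        using col[of m l] that \<open>l \<le> k\<close> unfolding eq nat_int by simp
    qed (rule cop)
    \<comment> \<open>With difference Q^m - n the position inside the block drops by n at each term,
      so the pattern is read downwards from its last position.\<close>
    have "\<not> has_AP v a (int Q ^ m + - int n) (Q ^ m + k)"
    proof (rule none[of m "- int n" "int (p + k * n)"])
      fix l assume "l \<le> k"
      then have eq: "int (p + k * n) + int l * - int n = int (p + (k - l) * n)"
        by (simp add: of_nat_diff left_diff_distrib)
      show "0 \<le> int (p + k * n) + int l * - int n
          \<and> int (p + k * n) + int l * - int n < int Q ^ m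
          \<and> subst_pow \<rho> m (v 0) ! nat (int (p + k * n) + int l * - int n) = a"
        using col[of m "k - l"] that unfolding eq nat_int by simp
    qed (use cop in simp)
    then show "\<not> has_AP v a (int Q ^ m - int n) (Q ^ m + k)"
      by simp
  qed
  then show ?thesis
    by (intro exI[of _ "p + k * n + 1"]) simp
qed

section \<open>Assembling the three assertions\<close>

theorem theorem35:
  fixes \<rho> :: "'a::finite \<Rightarrow> 'a list" and Q k :: nat
    and v :: "int \<Rightarrow> 'a" and \<mu> :: "(int \<Rightarrow> 'a) measure"
  assumes "substitution \<rho>"
    and "primitive_subst \<rho>"
    and "bijective_subst Q \<rho>"
    and "Q \<ge> 2"
    and "k > 0"
    and "\<And>a. replicate (k + 1) a \<notin> language \<rho>"
    and "fixed_point Q \<rho> v"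
    and "repetitive v"
    and "invariant_prob (orbit_closure v) \<mu>"
  shows
    "((\<exists>n>0. \<exists>a. measure \<mu> (C_set k v n a) > 0) \<and>
      (\<forall>n>0. \<forall>a. \<forall>s. \<forall>n'>0. measure \<mu> (C_set k v n a) > 0 \<and> n = Q ^ s * n' \<longrightarrow>
         (\<exists>b. measure \<mu> (C_set k v n' b) > 0)) \<and>
      (\<forall>n>0. \<forall>a. \<forall>m. measure \<mu> (C_set k v n a) > 0 \<and> (\<forall>c. set (subst_pow \<rho> m c) = UNIV) \<longrightarrow>
         (\<forall>b. measure \<mu> (C_set k v (Q ^ m * n) b) > 0)))
    \<and>
     (\<forall>a. \<forall>n>0. measure \<mu> (C_set k v n a) > 0 \<and> coprime n Q \<longrightarrow>
        (\<exists>m\<^sub>0>0. \<forall>m>m\<^sub>0.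
           \<not> has_AP v a (int Q ^ m + int n) (Q ^ m + k) \<and>
           \<not> has_AP v a (int Q ^ m - int n) (Q ^ m + k)))
    \<and>
     (CARD('a) = 2 \<longrightarrow>
        (\<exists>n>0. \<exists>m\<^sub>0>0. \<forall>s. \<forall>m\<ge>m\<^sub>0. \<forall>b.
           \<not> has_AP v b (int Q ^ (m + s) + int Q ^ s * int n) (Q ^ m + k) \<and>
           \<not> has_AP v b (int Q ^ (m + s) - int Q ^ s * int n) (Q ^ m + k)))"
proof -
  have bs: "bijective_subst Q \<rho>" and fp: "fixed_point Q \<rho> v" and Q: "2 \<le> Q"
    and rep: "repetitive v" and prim: "primitive_subst \<rho>"
    and lang: "\<And>a. replicate (k + 1) a \<notin> language \<rho>"
    using assms by blast+
  have cl: "constant_length Q \<rho>"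
    using bs by (simp add: bijective_subst_def)
  note pos_iff = measure_C_set_pos_iff[OF assms(9) rep]
  obtain n where n: "n > 0" "coprime n Q" "\<And>a. has_pattern v k n a"
    using exists_coprime_pattern[OF prim bs fp Q] by blast
  have desubst: "\<exists>b. has_pattern v k n' b" if "has_pattern v k (Q ^ s * n') a" for s n' a
    using has_AP_desubstitute[OF bs fp, of a s "int n'" "k + 1"] that Q
    by (simp add: has_pattern_iff_has_AP)
  have part3: "\<exists>n>0. \<exists>m\<^sub>0>0. \<forall>s. \<forall>m\<ge>m\<^sub>0. \<forall>b.
           \<not> has_AP v b (int Q ^ (m + s) + int Q ^ s * int n) (Q ^ m + k) \<and>
           \<not> has_AP v b (int Q ^ (m + s) - int Q ^ s * int n) (Q ^ m + k)"
  proof -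
    obtain m\<^sub>0 where m\<^sub>0: "\<And>b m. m > m\<^sub>0 b \<Longrightarrow>
           \<not> has_AP v b (int Q ^ m + int n) (Q ^ m + k) \<and>
           \<not> has_AP v b (int Q ^ m - int n) (Q ^ m + k)"
      using no_long_AP[OF bs fp Q rep lang n(2) n(3)] by metis
    \<comment> \<open>The chosen n has a pattern for every letter, so each letter b has a threshold
      \<open>m\<^sub>0 b\<close>; the alphabet is finite, so they have a maximum.\<close>
    define M where "M = Suc (Max (range m\<^sub>0))"
    have M: "m > m\<^sub>0 b" if "m \<ge> M" for m b
    proof -
      have "m\<^sub>0 b \<le> Max (range m\<^sub>0)"
        by (rule Max_ge) auto
      then show ?thesis
        using that unfolding M_def by linarith
    qed
    have "\<not> has_AP v b (int Q ^ (m + s) + int Q ^ s * int n) (Q ^ m + k) \<and>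
          \<not> has_AP v b (int Q ^ (m + s) - int Q ^ s * int n) (Q ^ m + k)"
      if "m \<ge> M" for s m b
    proof -
      \<comment> \<open>Pulling out Q^s allows desubstitution, which keeps the length but may change
        the letter; hence the threshold M serves all letters at once.\<close>
      have eq: "int Q ^ (m + s) + int Q ^ s * int n = int Q ^ s * (int Q ^ m + int n)"
        "int Q ^ (m + s) - int Q ^ s * int n = int Q ^ s * (int Q ^ m - int n)"
        by (simp_all add: power_add algebra_simps)
      have "Q > 0"
        using Q by simp
      then show ?thesis
        unfolding eq using has_AP_desubstitute[OF bs fp] m\<^sub>0 M[OF that] by metis
    qed
    moreover have "M > 0"
      by (simp add: M_def)
    ultimately show ?thesis
      using n(1) by blast
  qed
  show ?thesis
    unfolding pos_iff
  proof (intro conjI allI impI)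
    show "\<exists>n>0. \<exists>a. has_pattern v k n a"
      using n by blast
  next
    fix n a s n'
    assume "has_pattern v k n a \<and> n = Q ^ s * n'"
    then show "\<exists>b. has_pattern v k n' b"
      using desubst by blast
  next
    fix n a m b
    assume "has_pattern v k n a \<and> (\<forall>c. set (subst_pow \<rho> m c) = UNIV)"
    then show "has_pattern v k (Q ^ m * n) b"
      using has_pattern_substitute[OF cl fp] by blast
  next
    fix a n
    assume "has_pattern v k n a \<and> coprime n Q"
    then show "\<exists>m\<^sub>0>0. \<forall>m>m\<^sub>0.
           \<not> has_AP v a (int Q ^ m + int n) (Q ^ m + k) \<and>
           \<not> has_AP v a (int Q ^ m - int n) (Q ^ m + k)"
      using no_long_AP[OF bs fp Q rep lang] by blast
  qed (rule part3)
qed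

end
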